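(* Let $\varphi$ be a non-constant analytic function in the unit disk $\mathbb{D}$ with $\varphi(\mathbb{D})\subset\mathbb{D}$. Then the lower hyperbolic order of $\varphi$ is zero: $$\mu(\varphi)=\inf_{z\in\mathbb{D}}|A_\varphi(z)|=0.$$
   Context: $\mathbb{D}$ is the open unit disk in $\mathbb{C}$. For $\varphi:\mathbb{D}\to\mathbb{D}$ analytic and non-constant, $$A_\varphi(z)=\frac{1-|z|^2}{2}\frac{\varphi''(z)}{\varphi'(z)}-\bar z+\frac{(1-|z|^2)\overline{\varphi(z)}\varphi'(z)}{1-|\varphi(z)|^2},$$ with $A_\varphi(z)=\infty$ at the zeros of $\varphi'$. The lower hyperbolic order of $\varphi$ is $\mu(\varphi):=\inf_{z\in\mathbb{D}}|A_\varphi(z)|$. *)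

theory Defs
  imports "HOL-Complex_Analysis.Complex_Analysis" "HOL-Library.Extended_Real"
begin

text \<open>Values in the extended complex plane: \<open>None\<close> is the point at infinity, attained at the
  zeros of \<open>\<phi>'\<close>.\<close>

definition hyp_A :: "(complex \<Rightarrow> complex) \<Rightarrow> complex \<Rightarrow> complex option" where
  "hyp_A \<phi> z =
     (if deriv \<phi> z = 0 then None
      else Some (of_real ((1 - (cmod z)\<^sup>2) / 2) * (deriv (deriv \<phi>) z / deriv \<phi> z) - cnj z
                 + of_real (1 - (cmod z)\<^sup>2) * cnj (\<phi> z) * deriv \<phi> z
                   / of_real (1 - (cmod (\<phi> z))\<^sup>2)))"

definition ext_cmod :: "complex option \<Rightarrow> ereal" where
  "ext_cmod w = (case w of None \<Rightarrow> \<infinity> | Some c \<Rightarrow> ereal (cmod c))"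

definition lower_hyp_order :: "(complex \<Rightarrow> complex) \<Rightarrow> ereal" where
  "lower_hyp_order \<phi> = (INF z\<in>ball 0 1. ext_cmod (hyp_A \<phi> z))"

end

theory Submission
  imports Defs
begin

text \<open>
  The function \<open>A\<^sub>\<phi>\<close> is a gradient. Let
  \<open>u(z) = (1 - \<bar>z\<bar>\<^sup>2) \<bar>\<phi>'(z)\<bar> / (1 - \<bar>\<phi>(z)\<bar>\<^sup>2)\<close>
  be the hyperbolic derivative; wherever \<open>\<phi>' \<noteq> 0\<close>, Wirtinger calculus gives
  \<open>A\<^sub>\<phi>(z) = (1 - \<bar>z\<bar>\<^sup>2) \<partial>(log u)/\<partial>z\<close>,
  so \<open>\<bar>A\<^sub>\<phi>\<bar>\<close> is, up to a constant factor, the length of the hyperbolic gradient of \<open>log u\<close>.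
  By the Schwarz-Pick inequality \<open>u \<le> 1\<close>, and a function that is bounded above on a
  complete manifold has points at which its gradient is arbitrarily small.

  In the disk this last principle is elementary. For \<open>\<epsilon> > 0\<close> the function
  \<open>u(z) (1 - \<bar>z\<bar>\<^sup>2)\<^sup>\<epsilon>\<close> tends to \<open>0\<close> at the unit circle because \<open>u\<close> is bounded, and it is not
  identically zero because \<open>\<phi>\<close> is not constant. Hence it has a positive maximum at some point
  \<open>z\<close> of the disk (lemma \<open>weighted_hyp_deriv_attains_max\<close>). There \<open>\<phi>'(z) \<noteq> 0\<close>, and the
  vanishing of the logarithmic gradient says exactly that \<open>A\<^sub>\<phi>(z) = \<epsilon> cnj z\<close>
  (lemma \<open>hyp_A_at_max\<close>). Thus \<open>\<bar>A\<^sub>\<phi>(z)\<bar> < \<epsilon>\<close>, and \<open>\<epsilon>\<close> was arbitrary.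
\<close>

section \<open>The Schwarz-Pick inequality\<close>

definition hyp_deriv :: "(complex \<Rightarrow> complex) \<Rightarrow> complex \<Rightarrow> real" where
  "hyp_deriv f z = (1 - (cmod z)\<^sup>2) * cmod (deriv f z) / (1 - (cmod (f z))\<^sup>2)"

lemma one_minus_cmod_sq_pos: "cmod z < 1 \<Longrightarrow> 0 < 1 - (cmod z)\<^sup>2"
  by (simp add: abs_square_less_1)

lemma Moebius_function_has_derivative:
  assumes "1 - cnj w * z \<noteq> 0"
  shows "(Moebius_function 0 w has_field_derivative
           of_real (1 - (cmod w)\<^sup>2) / (1 - cnj w * z)\<^sup>2) (at z)"
proof -
  have "((\<lambda>z. (z - w) / (1 - cnj w * z)) has_field_derivative
          (1 * (1 - cnj w * z) - (z - w) * (- cnj w)) / ((1 - cnj w * z) * (1 - cnj w * z))) (at z)"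
    using assms by (auto intro!: derivative_eq_intros)
  moreover have "1 * (1 - cnj w * z) - (z - w) * (- cnj w) = of_real (1 - (cmod w)\<^sup>2)"
    by (simp add: complex_norm_square algebra_simps del: of_real_power)
  moreover have "Moebius_function 0 w = (\<lambda>z. (z - w) / (1 - cnj w * z))"
    by (simp add: fun_eq_iff Moebius_function_simple)
  ultimately show ?thesis
    by (simp only: power2_eq_square[of "1 - cnj w * z"])
qed

text \<open>This is the derivative bound of the Schwarz lemma for \<open>F = N \<circ> f \<circ> M\<close>, where the disk
  automorphisms \<open>M\<close> and \<open>N\<close> carry \<open>0\<close> to \<open>a\<close> and \<open>f a\<close> to \<open>0\<close>; by the chain rule
  \<open>\<bar>F'(0)\<bar>\<close> is the hyperbolic derivative of \<open>f\<close> at \<open>a\<close>.\<close>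

lemma Schwarz_Pick_hyp_deriv:
  assumes hol: "f holomorphic_on ball 0 1" and im: "f ` ball 0 1 \<subseteq> ball 0 1"
    and a: "cmod a < 1"
  shows "hyp_deriv f a \<le> 1"
proof -
  define b where "b = f a"
  have b: "cmod b < 1" using im a by (force simp: b_def)
  define M where "M = Moebius_function 0 (-a)"
  define N where "N = Moebius_function 0 b"
  have M0: "M 0 = a" by (simp add: M_def Moebius_function_def)
  have Mim: "cmod (M z) < 1" if "cmod z < 1" for z
    using Moebius_function_norm_lt_1 that a by (simp add: M_def)
  have Nim: "cmod (N z) < 1" if "cmod z < 1" for z
    using Moebius_function_norm_lt_1 that b by (simp add: N_def)
  have fim: "cmod (f z) < 1" if "cmod z < 1" for z
    using im that by (force)
  have holM: "M holomorphic_on ball 0 1" and holN: "N holomorphic_on ball 0 1"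
    using Moebius_function_holomorphic a b by (auto simp: M_def N_def)
  define F where "F = N \<circ> (f \<circ> M)"
  have "(f \<circ> M) holomorphic_on ball 0 1"
    using Mim by (intro holomorphic_on_compose_gen[OF holM hol]) auto
  then have "F holomorphic_on ball 0 1"
    unfolding F_def using Mim fim by (intro holomorphic_on_compose_gen[OF _ holN]) auto
  moreover have "F 0 = 0"
    by (simp add: F_def M0 N_def b_def Moebius_function_eq_zero)
  moreover have "cmod (F z) < 1" if "cmod z < 1" for z
    using that Mim fim Nim by (simp add: F_def)
  ultimately have "cmod (deriv F 0) \<le> 1"
    using Schwarz_Lemma(2)[of F 0] by simp
  moreover have "deriv F 0 = 1 / of_real (1 - (cmod b)\<^sup>2) * (deriv f a * of_real (1 - (cmod a)\<^sup>2))"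
  proof (rule DERIV_imp_deriv)
    have "(M has_field_derivative of_real (1 - (cmod a)\<^sup>2)) (at 0)"
      using Moebius_function_has_derivative[of "-a" 0] by (simp add: M_def)
    moreover have "(f has_field_derivative deriv f a) (at (M 0))"
      using hol a by (auto simp: M0 intro: holomorphic_derivI)
    ultimately have fM: "(f \<circ> M has_field_derivative deriv f a * of_real (1 - (cmod a)\<^sup>2)) (at 0)"
      by (rule DERIV_chain[rotated])
    have eq: "1 - cnj b * b = of_real (1 - (cmod b)\<^sup>2)"
      by (simp add: complex_norm_square mult.commute del: of_real_power)
    have nz: "1 - (cmod b)\<^sup>2 \<noteq> 0" using one_minus_cmod_sq_pos[OF b] by simp
    have "1 - cnj b * b \<noteq> 0" unfolding eq using nz of_real_eq_0_iff by blast
    from Moebius_function_has_derivative[OF this]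
    have "(N has_field_derivative of_real (1 - (cmod b)\<^sup>2) / (of_real (1 - (cmod b)\<^sup>2))\<^sup>2) (at b)"
      unfolding N_def eq .
    moreover have "of_real x / (of_real x)\<^sup>2 = (1 / of_real x :: complex)" for x
      by (simp add: power2_eq_square)
    moreover have "(f \<circ> M) 0 = b" by (simp add: M0 b_def)
    ultimately have "(N has_field_derivative 1 / of_real (1 - (cmod b)\<^sup>2)) (at ((f \<circ> M) 0))"
      by (simp only:)
    from DERIV_chain[OF this fM]
    show "(F has_field_derivative
        1 / of_real (1 - (cmod b)\<^sup>2) * (deriv f a * of_real (1 - (cmod a)\<^sup>2))) (at 0)"
      by (simp add: F_def)
  qed
  ultimately show ?thesis
    using one_minus_cmod_sq_pos[OF a] one_minus_cmod_sq_pos[OF b]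
    by (simp only: hyp_deriv_def b_def norm_mult norm_divide norm_of_real norm_one abs_of_pos)
       (simp add: mult.commute)
qed

section \<open>A maximum of the weighted hyperbolic derivative\<close>

text \<open>The weight forces decay at the circle. Let \<open>v > 0\<close> be the value of the weighted function at a
  point \<open>p\<close> with \<open>f'(p) \<noteq> 0\<close>. Since the hyperbolic derivative is at most \<open>1\<close>, any point with
  value at least \<open>v\<close> satisfies \<open>1 - \<bar>z\<bar>\<^sup>2 \<ge> v powr (1/\<epsilon>)\<close>. This inequality defines a compact
  subset \<open>K\<close> of the disk, so the maximum over \<open>K\<close> is a maximum over the disk.\<close>

lemma weighted_hyp_deriv_attains_max:
  assumes hol: "f holomorphic_on ball 0 1" and im: "f ` ball 0 1 \<subseteq> ball 0 1"
    and nc: "\<not> f constant_on ball 0 1" and eps: "0 < (\<epsilon>::real)"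
  obtains z where "cmod z < 1" "deriv f z \<noteq> 0"
    "\<And>y. cmod y < 1 \<Longrightarrow>
       hyp_deriv f y * (1 - (cmod y)\<^sup>2) powr \<epsilon> \<le> hyp_deriv f z * (1 - (cmod z)\<^sup>2) powr \<epsilon>"
proof -
  define V where "V = (\<lambda>y. hyp_deriv f y * (1 - (cmod y)\<^sup>2) powr \<epsilon>)"
  have fim: "cmod (f z) < 1" if "cmod z < 1" for z
    using im that by force
  have "\<exists>p\<in>ball 0 1. deriv f p \<noteq> 0"
  proof (rule ccontr)
    assume "\<not> ?thesis"
    then have "(f has_field_derivative 0) (at x)" if "x \<in> ball 0 1" for x
      using holomorphic_derivI[OF hol open_ball that] that by simp
    then have "f constant_on ball 0 1"
      by (metis (no_types, lifting) has_field_derivative_0_imp_constant_on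
            connected_ball open_ball)
    with nc show False by simp
  qed
  then obtain p where p: "cmod p < 1" "deriv f p \<noteq> 0" by auto
  define K where "K = {z. V p powr (1/\<epsilon>) \<le> 1 - (cmod z)\<^sup>2}"
  have Vp: "0 < V p"
    using p one_minus_cmod_sq_pos[of p] one_minus_cmod_sq_pos[OF fim, of p]
    by (simp add: V_def hyp_deriv_def)
  have K_ball: "cmod z < 1" if "z \<in> K" for z
  proof -
    have "0 < V p powr (1/\<epsilon>)" using Vp by simp
    then have "(cmod z)\<^sup>2 < 1" using that unfolding K_def mem_Collect_eq by linarith
    then show ?thesis by (simp add: abs_square_less_1)
  qed
  have outside: "V z < V p" if "cmod z < 1" "z \<notin> K" for z
  proof -
    have pos: "0 < 1 - (cmod z)\<^sup>2" using one_minus_cmod_sq_pos that by blast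
    have "V z \<le> 1 * (1 - (cmod z)\<^sup>2) powr \<epsilon>"
      unfolding V_def using Schwarz_Pick_hyp_deriv[OF hol im that(1)]
      by (intro mult_right_mono) auto
    also have "\<dots> < (V p powr (1/\<epsilon>)) powr \<epsilon>"
      using that(2) pos eps by (auto simp: K_def intro!: powr_less_mono2)
    also have "\<dots> = V p" using eps Vp by (simp add: powr_powr)
    finally show ?thesis .
  qed
  have "p \<in> K" using outside[OF p(1)] by blast
  have "closed K"
    unfolding K_def by (intro closed_Collect_le continuous_intros)
  moreover have "bounded K"
    using K_ball by (auto intro!: boundedI[of _ 1] less_imp_le)
  ultimately have "compact K" by (simp add: compact_eq_bounded_closed)
  have sub: "K \<subseteq> ball 0 1" using K_ball by auto
  have "continuous_on K f" "continuous_on K (deriv f)"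
    using hol holomorphic_deriv[OF hol open_ball] sub
    by (meson continuous_on_subset holomorphic_on_imp_continuous_on)+
  moreover have "1 - (cmod z)\<^sup>2 \<noteq> 0" "1 - (cmod (f z))\<^sup>2 \<noteq> 0" if "z \<in> K" for z
    using one_minus_cmod_sq_pos[of z] one_minus_cmod_sq_pos[of "f z"] fim[of z] K_ball[OF that]
    by auto
  ultimately have "continuous_on K V"
    unfolding V_def hyp_deriv_def by (intro continuous_intros) auto
  then obtain z where z: "z \<in> K" "\<And>y. y \<in> K \<Longrightarrow> V y \<le> V z"
    using continuous_attains_sup[OF \<open>compact K\<close>] \<open>p \<in> K\<close> by blast
  have "V p \<le> V z" using z \<open>p \<in> K\<close> by blast
  show thesis
  proof
    show "cmod z < 1" using K_ball z by blast
    show "deriv f z \<noteq> 0"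
      using Vp \<open>V p \<le> V z\<close> by (auto simp: V_def hyp_deriv_def)
    show "hyp_deriv f y * (1 - (cmod y)\<^sup>2) powr \<epsilon> \<le> hyp_deriv f z * (1 - (cmod z)\<^sup>2) powr \<epsilon>"
      if "cmod y < 1" for y
      using outside[OF that] z(2)[of y] \<open>V p \<le> V z\<close> unfolding V_def by fastforce
  qed
qed

section \<open>The critical point equation\<close>

lemma has_real_derivative_cmod_sq_along_line:
  assumes "(h has_field_derivative h') (at z)"
  shows "((\<lambda>t. (cmod (h (z + of_real t * w)))\<^sup>2) has_real_derivative
           2 * Re (cnj (h z) * h' * w)) (at 0)"
proof -
  have "((\<lambda>t. z + of_real t * w) has_vector_derivative w) (at 0)"
    by (auto intro!: derivative_eq_intros simp: has_vector_derivative_def scaleR_conv_of_real)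
  moreover have "(h has_field_derivative h') (at (z + of_real 0 * w))" using assms by simp
  ultimately have "(h \<circ> (\<lambda>t. z + of_real t * w) has_vector_derivative w * h') (at 0)"
    by (rule field_vector_diff_chain_at)
  then have d: "((\<lambda>t. h (z + of_real t * w)) has_derivative (\<lambda>x. x *\<^sub>R (w * h'))) (at 0)"
    by (simp add: has_vector_derivative_def o_def)
  have "((\<lambda>t. inner (h (z + of_real t * w)) (h (z + of_real t * w))) has_derivative
      (\<lambda>x. inner (h z) (x *\<^sub>R (w * h')) + inner (x *\<^sub>R (w * h')) (h z))) (at 0)"
    using has_derivative_inner[OF d d] by simp
  moreover have "(\<lambda>x. inner (h z) (x *\<^sub>R (w * h')) + inner (x *\<^sub>R (w * h')) (h z)) =
      (*) (2 * Re (cnj (h z) * h' * w))"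
    by (auto simp: fun_eq_iff inner_complex_def algebra_simps)
  ultimately show ?thesis
    by (simp add: has_field_derivative_def power2_norm_eq_inner)
qed

text \<open>At an interior maximum every directional derivative of
  \<open>log u + \<epsilon> log (1 - \<bar>z\<bar>\<^sup>2)\<close> vanishes. The derivative in direction \<open>w\<close> is \<open>Re (B w)\<close>, where
  \<open>B = 2 (A\<^sub>f - \<epsilon> cnj z) / (1 - \<bar>z\<bar>\<^sup>2)\<close>, and the direction \<open>w = cnj B\<close> yields \<open>B = 0\<close>.\<close>

lemma hyp_A_at_max:
  assumes hol: "f holomorphic_on ball 0 1" and im: "f ` ball 0 1 \<subseteq> ball 0 1"
    and z: "cmod z < 1" and nz: "deriv f z \<noteq> 0"
    and max: "\<And>y. cmod y < 1 \<Longrightarrow>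
       hyp_deriv f y * (1 - (cmod y)\<^sup>2) powr \<epsilon> \<le> hyp_deriv f z * (1 - (cmod z)\<^sup>2) powr \<epsilon>"
  shows "hyp_A f z = Some (of_real \<epsilon> * cnj z)"
proof -
  define P where "P = 1 - (cmod z)\<^sup>2"
  define Q where "Q = 1 - (cmod (f z))\<^sup>2"
  define B where "B = deriv (deriv f) z / deriv f z - 2 * of_real (1 + \<epsilon>) * cnj z / of_real P
      + 2 * cnj (f z) * deriv f z / of_real Q"
  define w where "w = cnj B"
  define l where "l = (\<lambda>t::real. z + of_real t * w)"
  have fim: "cmod (f y) < 1" if "cmod y < 1" for y
    using im that by force
  have P: "P > 0" and Q: "Q > 0"
    using one_minus_cmod_sq_pos z fim[OF z] by (auto simp: P_def Q_def)
  \<comment> \<open>The modulus of the derivative enters through its square, so that all three terms have the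
      form treated by the preceding lemma.\<close>
  define G where "G = (\<lambda>y. ln ((cmod (deriv f y))\<^sup>2) / 2 + (1 + \<epsilon>) * ln (1 - (cmod y)\<^sup>2)
      - ln (1 - (cmod (f y))\<^sup>2))"
  have G: "ln (hyp_deriv f y * (1 - (cmod y)\<^sup>2) powr \<epsilon>) = G y"
    and pos: "0 < hyp_deriv f y * (1 - (cmod y)\<^sup>2) powr \<epsilon>"
    if y: "cmod y < 1" "deriv f y \<noteq> 0" for y
  proof -
    have p: "0 < 1 - (cmod y)\<^sup>2" and q: "0 < 1 - (cmod (f y))\<^sup>2" and c: "0 < cmod (deriv f y)"
      using one_minus_cmod_sq_pos y fim by auto
    then show "0 < hyp_deriv f y * (1 - (cmod y)\<^sup>2) powr \<epsilon>"
      by (simp add: hyp_deriv_def)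
    show "ln (hyp_deriv f y * (1 - (cmod y)\<^sup>2) powr \<epsilon>) = G y"
      using p q c unfolding hyp_deriv_def G_def
      by (simp add: ln_mult ln_div ln_powr ln_realpow) (simp add: algebra_simps)
  qed
  have df: "(f has_field_derivative deriv f z) (at z)"
    and ddf: "(deriv f has_field_derivative deriv (deriv f) z) (at z)"
    using hol holomorphic_deriv[OF hol open_ball] z
    by (auto intro: holomorphic_derivI[where S = "ball 0 1"])
  have D: "((\<lambda>t. G (l t)) has_real_derivative
      2 * Re (cnj (deriv f z) * deriv (deriv f) z * w) / (cmod (deriv f z))\<^sup>2 / 2
      + (1 + \<epsilon>) * (- (2 * Re (cnj z * 1 * w)) / P)
      - (- (2 * Re (cnj (f z) * deriv f z * w)) / Q)) (at 0)"
  proof -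
    note d1 = has_real_derivative_cmod_sq_along_line[OF ddf, of w]
    note d2 = has_real_derivative_cmod_sq_along_line[OF DERIV_ident, of z w]
    note d3 = has_real_derivative_cmod_sq_along_line[OF df, of w]
    have "((\<lambda>t. ln (r t) / 2 + c * ln (1 - p t) - ln (1 - q t)) has_real_derivative
        r' / r 0 / 2 + c * (- p' / (1 - p 0)) - (- q' / (1 - q 0))) (at 0)"
      if "(r has_real_derivative r') (at 0)" "(p has_real_derivative p') (at 0)"
        "(q has_real_derivative q') (at 0)" "0 < r 0" "p 0 < 1" "q 0 < 1"
      for p q r :: "real \<Rightarrow> real" and p' q' r' c
      using that by (auto intro!: derivative_eq_intros simp: divide_simps)
        (simp add: algebra_simps)
    from this[OF d1 d2 d3, of "1 + \<epsilon>"] show ?thesis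
      using nz P Q by (simp add: G_def l_def P_def Q_def)
  qed
  have Re_eq: "2 * Re (cnj (deriv f z) * deriv (deriv f) z * w) / (cmod (deriv f z))\<^sup>2 / 2
      + (1 + \<epsilon>) * (- (2 * Re (cnj z * 1 * w)) / P)
      - (- (2 * Re (cnj (f z) * deriv f z * w)) / Q) = Re (B * w)"
  proof -
    have quot: "deriv (deriv f) z / deriv f z
        = cnj (deriv f z) * deriv (deriv f) z / of_real ((cmod (deriv f z))\<^sup>2)"
      using nz by (simp add: complex_norm_square del: of_real_power)
    have "B * w = cnj (deriv f z) * deriv (deriv f) z * w / of_real ((cmod (deriv f z))\<^sup>2)
        - of_real (2 * (1 + \<epsilon>)) * (cnj z * w) / of_real P
        + of_real 2 * (cnj (f z) * deriv f z * w) / of_real Q"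
      unfolding B_def quot by (simp add: algebra_simps)
    moreover have "Re (X / of_real r - of_real (2 * c) * Y / of_real p + of_real 2 * Z / of_real q)
        = 2 * Re X / r / 2 + c * (- (2 * Re Y) / p) - (- (2 * Re Z) / q)"
      for X Y Z :: complex and r c p q :: real
      by (simp only: minus_complex.simps plus_complex.simps Re_divide_of_real times_complex.simps
            Re_complex_of_real Im_complex_of_real) simp
    ultimately show ?thesis by (simp only: mult_1_right)
  qed
  have "Re (B * w) = 0"
  proof -
    have "open {y \<in> ball 0 1. deriv f y \<noteq> 0}"
      using continuous_open_preimage[OF holomorphic_on_imp_continuous_on
          [OF holomorphic_deriv[OF hol open_ball]] open_ball, of "-{0}"]
      by (simp add: vimage_def Int_def open_Compl)
    moreover have "continuous_on UNIV l" unfolding l_def by (intro continuous_intros)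
    ultimately have "open (l -` {y \<in> ball 0 1. deriv f y \<noteq> 0})"
      by (rule open_vimage)
    moreover have "0 \<in> l -` {y \<in> ball 0 1. deriv f y \<noteq> 0}"
      using z nz by (simp add: l_def)
    ultimately obtain d where d: "d > 0" "ball 0 d \<subseteq> l -` {y \<in> ball 0 1. deriv f y \<noteq> 0}"
      using open_contains_ball by blast
    have "G (l t) \<le> G (l 0)" if "\<bar>0 - t\<bar> < d" for t
    proof -
      have t: "cmod (l t) < 1" "deriv f (l t) \<noteq> 0"
        using d(2) that by (auto simp: subset_iff dist_real_def)
      have "ln (hyp_deriv f (l t) * (1 - (cmod (l t))\<^sup>2) powr \<epsilon>)
          \<le> ln (hyp_deriv f z * (1 - (cmod z)\<^sup>2) powr \<epsilon>)"
        using max[OF t(1)] pos[OF t] by (simp only: ln_mono)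
      then show ?thesis using G[OF t] G[OF z nz] by (simp add: l_def)
    qed
    then show ?thesis
      using DERIV_local_max[OF D d(1)] Re_eq by simp
  qed
  then have "B = 0"
    by (simp add: w_def complex_mult_cnj complex_eq_iff)
  have "of_real (P / 2) * (deriv (deriv f) z / deriv f z) - cnj z
      + of_real P * cnj (f z) * deriv f z / of_real Q = of_real (P / 2) * B + of_real \<epsilon> * cnj z"
    using P unfolding B_def by (simp add: field_simps)
  then show ?thesis
    using nz \<open>B = 0\<close> by (simp add: hyp_A_def P_def Q_def)
qed

section \<open>The lower hyperbolic order\<close>

theorem corollary2p2:
  fixes \<phi> :: "complex \<Rightarrow> complex"
  assumes "\<phi> analytic_on ball 0 1"
    and "\<not> \<phi> constant_on ball 0 1"
    and "\<phi> ` ball 0 1 \<subseteq> ball 0 1"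
  shows "lower_hyp_order \<phi> = 0"
proof (rule antisym)
  have hol: "\<phi> holomorphic_on ball 0 1"
    using assms(1) by (rule analytic_imp_holomorphic)
  show "lower_hyp_order \<phi> \<le> 0"
  proof (rule ereal_le_epsilon2)
    fix \<epsilon> :: real assume eps: "0 < \<epsilon>"
    obtain z where z: "cmod z < 1" "deriv \<phi> z \<noteq> 0"
      and max: "\<And>y. cmod y < 1 \<Longrightarrow> hyp_deriv \<phi> y * (1 - (cmod y)\<^sup>2) powr \<epsilon>
          \<le> hyp_deriv \<phi> z * (1 - (cmod z)\<^sup>2) powr \<epsilon>"
      using weighted_hyp_deriv_attains_max[OF hol assms(3,2) eps] by blast
    have "lower_hyp_order \<phi> \<le> ext_cmod (hyp_A \<phi> z)"
      unfolding lower_hyp_order_def using z by (intro INF_lower) simp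
    also have "\<dots> = ereal (\<epsilon> * cmod z)"
      using hyp_A_at_max[OF hol assms(3) z max] eps
      by (simp add: ext_cmod_def norm_mult)
    also have "\<dots> \<le> 0 + ereal \<epsilon>"
      using z eps by (simp add: mult_left_le)
    finally show "lower_hyp_order \<phi> \<le> 0 + ereal \<epsilon>" .
  qed
  show "0 \<le> lower_hyp_order \<phi>"
    unfolding lower_hyp_order_def
    by (intro INF_greatest) (simp add: ext_cmod_def split: option.split)
qed

end
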